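(* Let $n\ge 1$. The mapping $\varphi$ is a bijection of $\mathfrak{S}_n$ onto itself such that for all $\sigma\in\mathfrak{S}_n$, $\varphi(\sigma)(1)=\sigma(1)$ and $$\left(\widehat{\mathrm{Exc}}_v(\sigma),\mathrm{Drop}_v(\sigma),\widehat{\mathrm{Fix}}(\sigma)\right)=\left(\mathrm{Basc}_B(\varphi(\sigma)),\mathrm{Des}_B(\varphi(\sigma)),\mathrm{Suc}_B(\varphi(\sigma))\right).$$ In particular, $(\widehat{\mathrm{exc}}(\sigma),\mathrm{drop}(\sigma),\widehat{\mathrm{fix}}(\sigma))=(\mathrm{basc}(\varphi(\sigma)),\mathrm{des}(\varphi(\sigma)),\mathrm{suc}(\varphi(\sigma)))$.
   Context: $\mathfrak{S}_n$ is the symmetric group on $[n]$; $\sigma\in\mathfrak{S}_n$ is also written as the word $\sigma(1)\sigma(2)\cdots\sigma(n)$. Define the sets $\widehat{\mathrm{Fix}}(\sigma)=\{i:\sigma(i)=i,\ i\in\{2,\dots,n\}\}$, $\widehat{\mathrm{Exc}}_v(\sigma)=\{\sigma(i):\sigma(i)>i,\ i\in\{2,\dots,n\}\}$, $\mathrm{Drop}_v(\sigma)=\{\sigma(i):\sigma(i)<i,\ i\in[n]\}$, with cardinalities $\widehat{\mathrm{fix}}(\sigma),\widehat{\mathrm{exc}}(\sigma),\mathrm{drop}(\sigma)$; and $\mathrm{Basc}_B(\sigma)=\{\sigma(i+1):\sigma(i)+1<\sigma(i+1),\ i\in[n-1]\}$, $\mathrm{Des}_B(\sigma)=\{\sigma(i+1):\sigma(i)>\sigma(i+1),\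 i\in[n-1]\}$, $\mathrm{Suc}_B(\sigma)=\{\sigma(i+1):\sigma(i)+1=\sigma(i+1),\ i\in[n-1]\}$, with cardinalities $\mathrm{basc}(\sigma),\mathrm{des}(\sigma),\mathrm{suc}(\sigma)$. Definition of $\varphi$: for $\pi\in\mathfrak{S}_n$ let $\theta_1(\pi)\in\mathfrak{S}_n$ be the word obtained by writing $\pi$ as a product of disjoint cycles (fixed points included; a cycle $(a_1,\dots,a_k)$ means $a_1\mapsto a_2\mapsto\cdots\mapsto a_k\mapsto a_1$), each written with its largest letter at the end, arranging the cycles from left to right in decreasing order of their largest letters, and erasing the parentheses. For $\sigma\in\mathfrak{S}_n$ let $\sigma'$ be the permutation with word $\sigma'=\sigma(2)\sigma(3)\cdots\sigma(n)\sigma(1)$, and set $\varphi(\sigma)=\theta_1(\sigma')$. For example, for $\sigma=142836759$: $\sigma'=428367591$, with cycles $(1\,4\,3\,8\,9)(5\,6\,7)(2)$, so $\varphi(\sigma)=143895672$. *)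

theory Defs
  imports "HOL-Combinatorics.Combinatorics"
begin

text \<open>
  A permutation of \<open>[n]\<close> is a function \<open>\<sigma> :: nat \<Rightarrow> nat\<close> with \<open>\<sigma> permutes {1..n}\<close>; it is the
  identity outside \<open>[n]\<close>, so these functions correspond one-to-one to the elements of the
  symmetric group.
\<close>

definition Sym_grp :: "nat \<Rightarrow> (nat \<Rightarrow> nat) set" where
  "Sym_grp n = {\<sigma>. \<sigma> permutes {1..n}}"

definition Fix_hat :: "nat \<Rightarrow> (nat \<Rightarrow> nat) \<Rightarrow> nat set" where
  "Fix_hat n \<sigma> = {i. \<sigma> i = i \<and> i \<in> {2..n}}"

definition Exc_hat_v :: "nat \<Rightarrow> (nat \<Rightarrow> nat) \<Rightarrow> nat set" where
  "Exc_hat_v n \<sigma> = {\<sigma> i | i. \<sigma> i > i \<and> i \<in> {2..n}}"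

definition Drop_v :: "nat \<Rightarrow> (nat \<Rightarrow> nat) \<Rightarrow> nat set" where
  "Drop_v n \<sigma> = {\<sigma> i | i. \<sigma> i < i \<and> i \<in> {1..n}}"

definition fix_hat :: "nat \<Rightarrow> (nat \<Rightarrow> nat) \<Rightarrow> nat" where
  "fix_hat n \<sigma> = card (Fix_hat n \<sigma>)"

definition exc_hat :: "nat \<Rightarrow> (nat \<Rightarrow> nat) \<Rightarrow> nat" where
  "exc_hat n \<sigma> = card (Exc_hat_v n \<sigma>)"

definition drop_num :: "nat \<Rightarrow> (nat \<Rightarrow> nat) \<Rightarrow> nat" where
  "drop_num n \<sigma> = card (Drop_v n \<sigma>)"

definition Basc_B :: "nat \<Rightarrow> (nat \<Rightarrow> nat) \<Rightarrow> nat set" where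
  "Basc_B n \<sigma> = {\<sigma> (i + 1) | i. \<sigma> i + 1 < \<sigma> (i + 1) \<and> i \<in> {1..n - 1}}"

definition Des_B :: "nat \<Rightarrow> (nat \<Rightarrow> nat) \<Rightarrow> nat set" where
  "Des_B n \<sigma> = {\<sigma> (i + 1) | i. \<sigma> i > \<sigma> (i + 1) \<and> i \<in> {1..n - 1}}"

definition Suc_B :: "nat \<Rightarrow> (nat \<Rightarrow> nat) \<Rightarrow> nat set" where
  "Suc_B n \<sigma> = {\<sigma> (i + 1) | i. \<sigma> i + 1 = \<sigma> (i + 1) \<and> i \<in> {1..n - 1}}"

definition basc_num :: "nat \<Rightarrow> (nat \<Rightarrow> nat) \<Rightarrow> nat" where
  "basc_num n \<sigma> = card (Basc_B n \<sigma>)"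

definition des_num :: "nat \<Rightarrow> (nat \<Rightarrow> nat) \<Rightarrow> nat" where
  "des_num n \<sigma> = card (Des_B n \<sigma>)"

definition suc_num :: "nat \<Rightarrow> (nat \<Rightarrow> nat) \<Rightarrow> nat" where
  "suc_num n \<sigma> = card (Suc_B n \<sigma>)"

text \<open>The permutation of \<open>{1..length w}\<close> with word \<open>w\<close>; letters of the word are numbered from 1.\<close>

definition perm_of_word :: "nat list \<Rightarrow> nat \<Rightarrow> nat" where
  "perm_of_word w i = (if i \<in> {1..length w} then w ! (i - 1) else i)"

text \<open>
  \<open>support \<pi> x\<close> is the list \<open>[x, \<pi> x, \<pi> (\<pi> x), \<dots>]\<close> of the letters of the cycle of \<open>\<pi>\<close> through \<open>x\<close>.
  Started at \<open>\<pi> m\<close>, it writes the cycle of \<open>m\<close> with \<open>m\<close> as its last letter.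
\<close>

definition cycle_maxima :: "nat \<Rightarrow> (nat \<Rightarrow> nat) \<Rightarrow> nat set" where
  "cycle_maxima n \<pi> = {m \<in> {1..n}. m = Max (set (support \<pi> m))}"

definition cycles_list :: "nat \<Rightarrow> (nat \<Rightarrow> nat) \<Rightarrow> nat list list" where
  "cycles_list n \<pi> =
     map (\<lambda>m. support \<pi> (\<pi> m)) (rev (sorted_list_of_set (cycle_maxima n \<pi>)))"

definition theta1 :: "nat \<Rightarrow> (nat \<Rightarrow> nat) \<Rightarrow> nat \<Rightarrow> nat" where
  "theta1 n \<pi> = perm_of_word (concat (cycles_list n \<pi>))"

definition shift_perm :: "nat \<Rightarrow> (nat \<Rightarrow> nat) \<Rightarrow> nat \<Rightarrow> nat" where
  "shift_perm n \<sigma> = perm_of_word (map \<sigma> ([2..<n + 1] @ [1]))"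

definition phi :: "nat \<Rightarrow> (nat \<Rightarrow> nat) \<Rightarrow> nat \<Rightarrow> nat" where
  "phi n \<sigma> = theta1 n (shift_perm n \<sigma>)"

end

theory Submission
  imports Defs
begin

text \<open>
  Let \<open>p\<close> be the shifted permutation, so that \<open>p (i - 1) = \<sigma> i\<close> for \<open>2 \<le> i \<le> n\<close> and
  \<open>p n = \<sigma> 1\<close>. Comparing \<open>i\<close> with \<open>v = \<sigma> i\<close> is then comparing the successor of the preimage
  of \<open>v\<close> under \<open>p\<close> with \<open>v\<close>, whereas the statistics of a word compare the successor of the letter
  \<^emph>\<open>standing before\<close> \<open>v\<close> with \<open>v\<close>. In the word of the cycles of \<open>p\<close>, the letter before \<open>v\<close>
  is the preimage of \<open>v\<close>, unless \<open>v\<close> opens a cycle. In that case the preimage of \<open>v\<close> is the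
  largest letter of the cycle of \<open>v\<close>, and the letter before \<open>v\<close> is the still larger maximum of
  the preceding cycle. Both are at least \<open>v\<close>, so both comparisons report a drop. This is the
  content of \<open>successively_concat_blocks\<close>, and \<open>phi_adjacent_iff\<close> turns it into the three
  equivalences between excedances, fixed points, drops and ascents, successions, descents. The
  letters compared are the same on both sides: every letter except the first, and \<open>phi n \<sigma>\<close>
  and \<open>\<sigma>\<close> have the same first letter since the cycle of \<open>n\<close> comes first and starts with \<open>p n\<close>.

  The word determines the cycles, because a list of blocks that end at their maxima, with these
  maxima decreasing, can be read off from its concatenation: the first block ends at the largest
  letter of the whole word (\<open>standard_blocks_unique\<close>). The cycles determine \<open>p\<close>, and \<open>p\<close>
  determines \<open>\<sigma>\<close>. Hence \<open>phi n\<close> is an injective self-map of a finite set, and so a bijection.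
\<close>

section \<open>Words and permutations\<close>

lemma perm_of_word_permutes:
  assumes "distinct w" "set w = {1..length w}"
  shows "perm_of_word w permutes {1..length w}"
proof (rule bij_imp_permutes)
  have "inj_on (perm_of_word w) {1..length w}"
    using assms(1) by (auto simp: inj_on_def perm_of_word_def nth_eq_iff_index_eq)
  moreover have "perm_of_word w ` {1..length w} \<subseteq> {1..length w}"
  proof
    fix y assume "y \<in> perm_of_word w ` {1..length w}"
    then obtain i where i: "i \<in> {1..length w}" "y = w ! (i - 1)"
      by (auto simp: perm_of_word_def)
    then have "y \<in> set w" by auto
    then show "y \<in> {1..length w}" using assms(2) by simp
  qed
  ultimately show "bij_betw (perm_of_word w) {1..length w} {1..length w}"
    by (simp add: bij_betw_def endo_inj_surj)
qed (auto simp: perm_of_word_def)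

lemma perm_of_word_inject:
  assumes "length v = length w" "perm_of_word v = perm_of_word w"
  shows "v = w"
proof (rule nth_equalityI)
  fix i assume "i < length v"
  then have "perm_of_word v (Suc i) = v ! i" "perm_of_word w (Suc i) = w ! i"
    using assms(1) by (auto simp: perm_of_word_def)
  then show "v ! i = w ! i" using assms(2) by simp
qed (fact assms(1))

lemma shift_perm_less:
  assumes "i \<in> {1..<n}"
  shows "shift_perm n \<sigma> i = \<sigma> (i + 1)"
  using assms by (auto simp: shift_perm_def perm_of_word_def nth_append simp del: upt_Suc)

lemma shift_perm_last:
  assumes "n \<ge> 1"
  shows "shift_perm n \<sigma> n = \<sigma> 1"
proof -
  have "n - 1 = length (map \<sigma> [2..<n + 1])" by (simp del: upt_Suc)
  then have "map \<sigma> ([2..<n + 1] @ [1]) ! (n - 1) = \<sigma> 1"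
    by (simp only: map_append list.map nth_append_length)
  then show ?thesis
    using assms unfolding shift_perm_def perm_of_word_def by (simp del: map_append upt_Suc)
qed

lemma shift_perm_permutes:
  assumes "n \<ge> 1" "\<sigma> permutes {1..n}"
  shows "shift_perm n \<sigma> permutes {1..n}"
proof -
  let ?w = "map \<sigma> ([2..<n + 1] @ [1])"
  have len: "length ?w = n" using assms(1) by (simp del: upt_Suc)
  have letters: "set ([2..<n + 1] @ [1]) = {1..n}" using assms(1) by auto
  have "distinct ?w"
    unfolding distinct_map letters using permutes_inj_on[OF assms(2)] by (simp del: upt_Suc)
  moreover have "set ?w = {1..n}"
    unfolding set_map letters using permutes_image[OF assms(2)] .
  ultimately show ?thesis
    using perm_of_word_permutes[of ?w] unfolding len shift_perm_def by blast
qed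

lemma shift_perm_inj:
  assumes "n \<ge> 1" "\<sigma> permutes {1..n}" "\<tau> permutes {1..n}" "shift_perm n \<sigma> = shift_perm n \<tau>"
  shows "\<sigma> = \<tau>"
proof
  fix i
  consider "i = 1" | "i \<in> {2..n}" | "i \<notin> {1..n}" by fastforce
  then show "\<sigma> i = \<tau> i"
  proof cases
    case 1
    then show ?thesis using assms(1,4) shift_perm_last by metis
  next
    case 2
    then have "i - 1 \<in> {1..<n}" "i = (i - 1) + 1" by auto
    then show ?thesis using assms(4) shift_perm_less by metis
  next
    case 3
    then show ?thesis using assms(2,3) by (simp add: permutes_not_in)
  qed
qed

section \<open>Blocks ending at their maxima\<close>

text \<open>
  This is the shape of Foata's canonical cycle notation, stated for arbitrary lists of blocks so
  that its uniqueness can be proved without reference to a permutation.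
\<close>

definition standard_blocks :: "'a::linorder list list \<Rightarrow> bool" where
  "standard_blocks bs \<longleftrightarrow>
     (\<forall>b \<in> set bs. b \<noteq> [] \<and> (\<forall>x \<in> set b. x \<le> last b)) \<and>
     sorted_wrt (\<lambda>b c. last c < last b) bs"

text \<open>
  A form for induction: since each block is bounded by its last letter, comparing the last letters
  of the blocks amounts to comparing the last letter of the first block with every later letter.
\<close>

lemma standard_blocks_Cons:
  "standard_blocks (b # bs) \<longleftrightarrow>
     b \<noteq> [] \<and> (\<forall>x \<in> set b. x \<le> last b) \<and> (\<forall>x \<in> set (concat bs). x < last b) \<and>
     standard_blocks bs"
proof -
  have "(\<forall>c \<in> set bs. last c < last b) \<longleftrightarrow> (\<forall>x \<in> set (concat bs). x < last b)"
    if "\<forall>c \<in> set bs. c \<noteq> [] \<and> (\<forall>x \<in> set c. x \<le> last c)"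
    using that by (auto dest: le_less_trans)
  then show ?thesis by (auto simp: standard_blocks_def)
qed

text \<open>
  The last letter of the first block is the largest letter of the word. As the letters are
  distinct, its position in the word fixes where the first block ends; induction does the rest.
\<close>

lemma standard_blocks_unique:
  assumes "standard_blocks bs" "standard_blocks cs" "distinct (concat bs)" "concat bs = concat cs"
  shows "bs = cs"
  using assms
proof (induction bs arbitrary: cs)
  case Nil
  then show ?case by (cases cs) (auto simp: standard_blocks_Cons)
next
  case (Cons b bs)
  then obtain c cs' where cs: "cs = c # cs'"
    by (cases cs) (auto simp: standard_blocks_Cons)
  note bs = Cons.prems(1)[unfolded standard_blocks_Cons]
  note cs' = Cons.prems(2)[unfolded cs standard_blocks_Cons]
  \<comment> \<open>Both last letters are the maximum of the common word.\<close>
  have word: "b @ concat bs = c @ concat cs'" using Cons.prems(4) cs by simp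
  have "last b \<in> set (c @ concat cs')" "last c \<in> set (b @ concat bs)"
    using word bs cs' by (metis Un_iff last_in_set set_append)+
  then have last: "last b = last c"
    using bs cs' by (fastforce dest: order_antisym less_imp_le)
  define u v where "u = butlast b" and "v = butlast c"
  have b: "b = u @ [last b]" and c: "c = v @ [last b]"
    unfolding u_def v_def using bs cs' by (simp, simp add: last)
  have word': "u @ last b # concat bs = v @ last b # concat cs'"
    using word by (subst (asm) b, subst (asm) c) simp
  have "concat (b # bs) = u @ last b # concat bs"
    using b by (metis append.assoc append_Cons append_Nil concat.simps(2))
  then have distinct: "distinct (u @ last b # concat bs)"
    using Cons.prems(3) by metis
  then have "last b \<notin> set u" "last b \<notin> set (concat bs)" by auto
  then have "u = v" "concat bs = concat cs'"
    using word' append_Cons_eq_iff by metis+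
  moreover have "distinct (concat bs)" using distinct by simp
  ultimately have "bs = cs'" using Cons.IH[of cs'] bs cs' by blast
  moreover have "b = c" using b c \<open>u = v\<close> by metis
  ultimately show ?case using cs by simp
qed

section \<open>Cycles as lists\<close>

definition closed_orbit :: "('a \<Rightarrow> 'a) \<Rightarrow> 'a list \<Rightarrow> bool" where
  "closed_orbit p b \<longleftrightarrow> b \<noteq> [] \<and> successively (\<lambda>x y. y = p x) b \<and> hd b = p (last b)"

text \<open>
  Each letter of a cycle is followed, cyclically, by its image. This is how a permutation is
  recovered from its list of cycles.
\<close>

lemma closed_orbit_determines:
  assumes "closed_orbit p b" "closed_orbit q b" "x \<in> set b"
  shows "p x = q x"
proof -
  obtain i where i: "i < length b" "x = b ! i" using assms(3) by (auto simp: in_set_conv_nth)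
  show ?thesis
  proof (cases "Suc i < length b")
    case True
    then have "b ! Suc i = p (b ! i)" "b ! Suc i = q (b ! i)"
      using assms(1,2) by (simp_all add: closed_orbit_def successively_conv_nth)
    then show ?thesis using i(2) by simp
  next
    case False
    then have "x = last b" using i by (metis Suc_lessI diff_Suc_1 last_conv_nth list.size(3) not_less_zero)
    then show ?thesis using assms(1,2) by (simp add: closed_orbit_def)
  qed
qed

lemma mem_support_self:
  assumes "permutation p"
  shows "a \<in> set (support p a)"
  using least_power_of_permutation(2)[OF assms, of a] by force

lemma set_support_eq:
  assumes "permutation p" "b \<in> set (support p a)"
  shows "set (support p b) = set (support p a)"
proof -
  have "set (support p b) \<inter> set (support p a) \<noteq> {}"
    using disjoint_support'[OF assms(1)] assms(2) by blast
  then show ?thesis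
    using disjoint_support[OF assms(1)] unfolding disjoint_def by blast
qed

lemma image_mem_support:
  assumes "permutation p"
  shows "p a \<in> set (support p a)"
  unfolding support_set[OF assms] by (rule range_eqI[of _ _ 1]) simp

text \<open>
  Walking along the cycle of \<open>m\<close> from \<open>p m\<close> reaches \<open>m\<close> last, because \<open>m\<close> is the only
  preimage of the starting point. Hence the list of letters closes up at \<open>m\<close>.
\<close>

lemma support_image:
  assumes "permutation p"
  shows "closed_orbit p (support p (p m))" "last (support p (p m)) = m"
proof -
  let ?k = "least_power p (p m)"
  have k: "?k > 0" "(p ^^ ?k) (p m) = p m"
    using least_power_of_permutation[OF assms] by auto
  have "p ((p ^^ (?k - 1)) (p m)) = p m"
    using k by (metis Suc_diff_1 comp_apply funpow.simps(2))
  then have "(p ^^ (?k - 1)) (p m) = m"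
    using permutation_bijective[OF assms] by (metis bij_pointE)
  moreover have "last (support p (p m)) = (p ^^ (?k - 1)) (p m)"
    using k(1) by (simp add: last_map)
  ultimately show "last (support p (p m)) = m" by simp
  moreover have "hd (support p (p m)) = p m"
    using k(1) by (simp add: hd_map)
  moreover have "successively (\<lambda>x y. y = p x) (support p (p m))"
    by (auto simp: successively_conv_nth)
  ultimately show "closed_orbit p (support p (p m))"
    using k(1) by (simp add: closed_orbit_def)
qed

section \<open>The cycle word\<close>

context
  fixes n :: nat and p :: "nat \<Rightarrow> nat"
  assumes p: "p permutes {1..n}"
begin

lemma permutation_p: "permutation p"
  using p permutation_permutes by blast

lemma set_cycles_list:
  "set (cycles_list n p) = (\<lambda>m. support p (p m)) ` cycle_maxima n p"
  by (simp add: cycles_list_def cycle_maxima_def)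

lemma set_support_image: "set (support p (p m)) = set (support p m)"
  using set_support_eq image_mem_support permutation_p by metis

lemma cycles_list_closed_orbit:
  assumes "b \<in> set (cycles_list n p)"
  shows "closed_orbit p b"
  using assms support_image(1)[OF permutation_p] unfolding set_cycles_list by blast

lemma cycles_list_standard: "standard_blocks (cycles_list n p)"
proof -
  have "\<forall>b \<in> set (cycles_list n p). b \<noteq> [] \<and> (\<forall>x \<in> set b. x \<le> last b)"
  proof
    fix b assume "b \<in> set (cycles_list n p)"
    then obtain m where m: "m \<in> cycle_maxima n p" "b = support p (p m)"
      unfolding set_cycles_list by blast
    have "set b = set (support p m)" "last b = m"
      using m(2) set_support_image support_image(2)[OF permutation_p] by auto
    moreover have "m = Max (set (support p m))"
      using m(1) unfolding cycle_maxima_def by blast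
    moreover have "b \<noteq> []"
      using m(2) support_image(1)[OF permutation_p] unfolding closed_orbit_def by blast
    ultimately show "b \<noteq> [] \<and> (\<forall>x \<in> set b. x \<le> last b)"
      by (metis List.finite_set Max_ge)
  qed
  moreover have "sorted_wrt (\<lambda>b c. last c < last b) (cycles_list n p)"
    unfolding cycles_list_def sorted_wrt_map support_image(2)[OF permutation_p] sorted_wrt_rev
    by (rule strict_sorted_list_of_set)
  ultimately show ?thesis by (simp add: standard_blocks_def)
qed

text \<open>
  Two cycles that meet are equal and so have the same maximum. Hence the words of the cycles
  share no letter, and no cycle is written twice.
\<close>

lemma cycle_maxima_eqI:
  assumes "m \<in> cycle_maxima n p" "m' \<in> cycle_maxima n p"
    "set (support p m) \<inter> set (support p m') \<noteq> {}"
  shows "m = m'"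
proof -
  have "set (support p m) = set (support p m')"
    using assms(3) set_support_eq[OF permutation_p] by blast
  then show ?thesis
    using assms(1,2) unfolding cycle_maxima_def by (metis (mono_tags, lifting) mem_Collect_eq)
qed

lemma distinct_concat_cycles_list: "distinct (concat (cycles_list n p))"
proof (rule distinct_concat)
  have "inj_on (\<lambda>m. support p (p m)) (cycle_maxima n p)"
    by (rule inj_onI) (metis support_image(2)[OF permutation_p])
  then show "distinct (cycles_list n p)"
    by (simp add: cycles_list_def distinct_map cycle_maxima_def)
next
  fix b assume "b \<in> set (cycles_list n p)"
  then show "distinct b"
    unfolding set_cycles_list using cycle_of_permutation[OF permutation_p] by blast
next
  fix b c assume "b \<in> set (cycles_list n p)" "c \<in> set (cycles_list n p)" "b \<noteq> c"
  then show "set b \<inter> set c = {}"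
    unfolding set_cycles_list using cycle_maxima_eqI set_support_image by blast
qed

lemma support_subset:
  assumes "x \<in> {1..n}"
  shows "set (support p x) \<subseteq> {1..n}"
  using assms permutes_in_image[OF permutes_funpow[OF p]] by auto

text \<open>
  Every letter \<open>x\<close> occurs: the maximum of its cycle generates the same cycle, so it is a member of
  \<open>cycle_maxima n p\<close>.
\<close>

lemma set_concat_cycles_list: "set (concat (cycles_list n p)) = {1..n}"
proof
  show "set (concat (cycles_list n p)) \<subseteq> {1..n}"
  proof
    fix x assume "x \<in> set (concat (cycles_list n p))"
    then obtain m where m: "m \<in> cycle_maxima n p" "x \<in> set (support p (p m))"
      unfolding set_concat set_cycles_list by blast
    then have "m \<in> {1..n}" unfolding cycle_maxima_def by blast
    then show "x \<in> {1..n}" using m(2) set_support_image support_subset by blast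
  qed
  show "{1..n} \<subseteq> set (concat (cycles_list n p))"
  proof
    fix x assume x: "x \<in> {1..n}"
    define m where "m = Max (set (support p x))"
    have "x \<in> set (support p x)" by (rule mem_support_self[OF permutation_p])
    then have m: "m \<in> set (support p x)"
      unfolding m_def by (metis List.finite_set Max_in empty_iff)
    then have eq: "set (support p m) = set (support p x)"
      by (rule set_support_eq[OF permutation_p])
    have "m \<in> {1..n}" using m support_subset[OF x] by blast
    then have "m \<in> cycle_maxima n p"
      using eq m_def unfolding cycle_maxima_def by simp
    then show "x \<in> set (concat (cycles_list n p))"
      using \<open>x \<in> set (support p x)\<close> eq set_support_image
      unfolding set_concat set_cycles_list by blast
  qed
qed

lemma length_concat_cycles_list: "length (concat (cycles_list n p)) = n"
  using distinct_card[OF distinct_concat_cycles_list] set_concat_cycles_list by simp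

lemma theta1_permutes: "theta1 n p permutes {1..n}"
  using perm_of_word_permutes[OF distinct_concat_cycles_list]
  by (simp only: theta1_def length_concat_cycles_list set_concat_cycles_list)

text \<open>
  The last letter of the first block is the largest letter \<open>n\<close>, and the block closes up there, so
  its first letter is the image of \<open>n\<close>.
\<close>

lemma theta1_first:
  assumes "n \<ge> 1"
  shows "theta1 n p 1 = p n"
proof -
  obtain b bs where bs: "cycles_list n p = b # bs"
    using assms length_concat_cycles_list by (cases "cycles_list n p") auto
  have std: "b \<noteq> []" "\<forall>x \<in> set b. x \<le> last b" "\<forall>x \<in> set (concat bs). x < last b"
    using cycles_list_standard bs by (auto simp: standard_blocks_Cons)
  have letters: "set b \<union> set (concat bs) = {1..n}"
    using set_concat_cycles_list bs by simp
  then have "n \<le> last b"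
    using assms std(2,3) by (metis Un_iff atLeastAtMost_iff less_imp_le order_refl)
  moreover have "last b \<le> n"
    using letters std(1) by (metis Un_iff atLeastAtMost_iff last_in_set)
  ultimately have "last b = n" by simp
  then have "hd b = p n"
    using cycles_list_closed_orbit[of b] bs by (simp add: closed_orbit_def)
  moreover have "theta1 n p 1 = hd b"
    unfolding theta1_def perm_of_word_def length_concat_cycles_list
    using assms bs std(1) by (simp add: hd_conv_nth nth_append)
  ultimately show ?thesis by simp
qed

end

lemma theta1_inj:
  assumes p: "p permutes {1..n}" and q: "q permutes {1..n}" and eq: "theta1 n p = theta1 n q"
  shows "p = q"
proof
  have "concat (cycles_list n p) = concat (cycles_list n q)"
    using eq length_concat_cycles_list[OF p] length_concat_cycles_list[OF q]
    unfolding theta1_def by (intro perm_of_word_inject) simp_all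
  then have blocks: "cycles_list n p = cycles_list n q"
    using standard_blocks_unique cycles_list_standard[OF p] cycles_list_standard[OF q]
      distinct_concat_cycles_list[OF p] by blast
  fix x
  show "p x = q x"
  proof (cases "x \<in> {1..n}")
    case True
    then obtain b where "b \<in> set (cycles_list n p)" "x \<in> set b"
      using set_concat_cycles_list[OF p] by (metis UN_E set_concat)
    then show ?thesis
      using closed_orbit_determines cycles_list_closed_orbit[OF p] cycles_list_closed_orbit[OF q]
        blocks by metis
  next
    case False
    then show ?thesis using p q by (simp add: permutes_not_in)
  qed
qed

text \<open>
  Inside a block, the predecessor of a letter is its preimage. At a boundary between blocks, the
  word goes from the maximum of one block to the first letter \<open>y\<close> of the next one; \<open>y\<close> is the
  image of the maximum \<open>m\<close> of its own block, so \<open>y \<le> m\<close>, and \<open>m\<close> is smaller than the previous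
  maximum. So even where the predecessor is not the preimage, the two agree on not being less
  than \<open>y\<close>.
\<close>

lemma successively_concat_blocks:
  assumes "standard_blocks bs" "\<forall>b \<in> set bs. closed_orbit p b"
  shows "successively (\<lambda>x y. y = p x \<or> y < x \<and> (\<exists>m. y = p m \<and> y \<le> m)) (concat bs)"
    (is "successively ?R _")
  using assms
proof (induction bs)
  case (Cons b bs)
  have b: "b \<noteq> []" "successively (\<lambda>x y. y = p x) b"
    using Cons.prems(2) by (auto simp: closed_orbit_def)
  have "?R (last b) (hd (concat bs))" if ne: "concat bs \<noteq> []"
  proof -
    obtain c cs where cs: "bs = c # cs" using ne by (cases bs) auto
    have c: "c \<noteq> []" "hd c = p (last c)" "\<forall>x \<in> set c. x \<le> last c"
      using Cons.prems cs by (auto simp: closed_orbit_def standard_blocks_Cons)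
    have "hd c \<in> set c" using c(1) by simp
    then have "hd c < last b" "hd c \<le> last c"
      using Cons.prems(1) cs c(3) by (simp_all add: standard_blocks_Cons)
    moreover have "hd (concat bs) = hd c" using c(1) cs by simp
    ultimately show ?thesis using c(2) by metis
  qed
  moreover have "successively ?R b"
    using b(2) by (rule successively_mono) simp
  moreover have "successively ?R (concat bs)"
    using Cons by (simp add: standard_blocks_Cons)
  ultimately show ?case by (simp only: concat.simps successively_append_iff) blast
qed simp

lemma theta1_adjacent:
  assumes p: "p permutes {1..n}" and j: "j \<in> {1..n - 1}"
  obtains "theta1 n p (j + 1) = p (theta1 n p j)"
  | m where "theta1 n p (j + 1) < theta1 n p j" "theta1 n p (j + 1) = p m"
      "theta1 n p (j + 1) \<le> m"
proof -
  let ?w = "concat (cycles_list n p)"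
  have nth: "theta1 n p j = ?w ! (j - 1)" "theta1 n p (j + 1) = ?w ! Suc (j - 1)"
    using j unfolding theta1_def perm_of_word_def length_concat_cycles_list[OF p] by auto
  have "successively (\<lambda>x y. y = p x \<or> y < x \<and> (\<exists>m. y = p m \<and> y \<le> m)) ?w"
    using cycles_list_standard[OF p] cycles_list_closed_orbit[OF p]
    by (intro successively_concat_blocks) auto
  moreover have "Suc (j - 1) < length ?w"
    using j unfolding length_concat_cycles_list[OF p] by auto
  ultimately show thesis
    unfolding successively_conv_nth nth[symmetric] using nth that by metis
qed

section \<open>Transport of the statistics\<close>

lemma phi_permutes:
  assumes "n \<ge> 1" "\<sigma> permutes {1..n}"
  shows "phi n \<sigma> permutes {1..n}"
  unfolding phi_def using assms by (intro theta1_permutes shift_perm_permutes)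

lemma phi_first:
  assumes "n \<ge> 1" "\<sigma> permutes {1..n}"
  shows "phi n \<sigma> 1 = \<sigma> 1"
  unfolding phi_def
  using theta1_first[OF shift_perm_permutes[OF assms] assms(1)] shift_perm_last[OF assms(1)] by simp

lemma bij_betw_phi:
  assumes "n \<ge> 1"
  shows "bij_betw (phi n) (Sym_grp n) (Sym_grp n)"
proof -
  have "inj_on (phi n) (Sym_grp n)"
  proof (rule inj_onI)
    fix \<sigma> \<tau> assume "\<sigma> \<in> Sym_grp n" "\<tau> \<in> Sym_grp n" "phi n \<sigma> = phi n \<tau>"
    then show "\<sigma> = \<tau>"
      unfolding Sym_grp_def phi_def
      using theta1_inj shift_perm_inj shift_perm_permutes assms by (metis mem_Collect_eq)
  qed
  moreover have "phi n ` Sym_grp n \<subseteq> Sym_grp n"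
    using phi_permutes[OF assms] by (auto simp: Sym_grp_def)
  moreover have "finite (Sym_grp n)"
    unfolding Sym_grp_def by (rule finite_permutations) simp
  ultimately show ?thesis by (simp add: bij_betw_def endo_inj_surj)
qed

text \<open>
  The preimage of \<open>\<sigma> i\<close> under the shifted permutation is \<open>i - 1\<close>. If it also precedes the letter
  \<open>\<sigma> i\<close> in the word, the comparisons are identical. If not, the letter opens a cycle, and both
  the descent and the drop hold.
\<close>

lemma phi_adjacent_iff:
  assumes n: "n \<ge> 1" and \<sigma>: "\<sigma> permutes {1..n}"
    and i: "i \<in> {2..n}" and j: "j \<in> {1..n - 1}" and v: "\<sigma> i = phi n \<sigma> (j + 1)"
  shows "phi n \<sigma> j + 1 < phi n \<sigma> (j + 1) \<longleftrightarrow> i < \<sigma> i"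
    and "phi n \<sigma> j + 1 = phi n \<sigma> (j + 1) \<longleftrightarrow> \<sigma> i = i"
    and "phi n \<sigma> j > phi n \<sigma> (j + 1) \<longleftrightarrow> \<sigma> i < i"
proof -
  let ?p = "shift_perm n \<sigma>"
  have p: "?p permutes {1..n}" by (rule shift_perm_permutes[OF n \<sigma>])
  have "i - 1 \<in> {1..<n}" "i - 1 + 1 = i" using i by auto
  then have shift: "?p (i - 1) = \<sigma> i" using shift_perm_less by metis
  have preimage: "m = i - 1" if "\<sigma> i = ?p m" for m
    using that shift permutes_inj[OF p] by (metis injD)
  have neq: "phi n \<sigma> j \<noteq> phi n \<sigma> (j + 1)"
    using permutes_inj[OF phi_permutes[OF n \<sigma>]] by (metis Suc_eq_plus1 injD n_not_Suc_n)
  have "phi n \<sigma> j = i - 1 \<or> \<sigma> i < phi n \<sigma> j \<and> \<sigma> i \<le> i - 1"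
    using theta1_adjacent[OF p j] preimage v unfolding phi_def by metis
  then show "phi n \<sigma> j + 1 < phi n \<sigma> (j + 1) \<longleftrightarrow> i < \<sigma> i"
    and "phi n \<sigma> j + 1 = phi n \<sigma> (j + 1) \<longleftrightarrow> \<sigma> i = i"
    and "phi n \<sigma> j > phi n \<sigma> (j + 1) \<longleftrightarrow> \<sigma> i < i"
    using i v neq by auto
qed

text \<open>
  The set of letters off the first position depends on the first letter alone; this is why
  \<open>phi n \<sigma> 1 = \<sigma> 1\<close> makes the values compared for \<open>\<sigma>\<close> and for \<open>phi n \<sigma>\<close> coincide.
\<close>

lemma noninitial_letters:
  fixes \<sigma> :: "nat \<Rightarrow> nat"
  assumes "\<sigma> permutes {1..n}"
  shows "{\<sigma> i | i. i \<in> {2..n}} = {1..n} - {\<sigma> 1}"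
proof -
  have "{\<sigma> i | i. i \<in> {2..n}} = \<sigma> ` ({1..n} - {1})"
  proof -
    have "{2..n} = {1..n} - {1}" by auto
    then show ?thesis by (simp only: Setcompr_eq_image Collect_mem_eq)
  qed
  also have "\<dots> = {1..n} - {\<sigma> 1}"
    using permutes_inj[OF assms] permutes_image[OF assms]
    by (simp add: image_set_diff)
  finally show ?thesis .
qed

text \<open>
  It suffices to compare conditions at positions that carry the same letter, since the letters
  off the first position are the same for \<open>\<sigma>\<close> and \<open>phi n \<sigma>\<close>.
\<close>

lemma phi_sets_eq:
  assumes n: "n \<ge> 1" and \<sigma>: "\<sigma> permutes {1..n}"
  assumes PQ: "\<And>i j. i \<in> {2..n} \<Longrightarrow> j \<in> {1..n - 1} \<Longrightarrow> \<sigma> i = phi n \<sigma> (j + 1) \<Longrightarrow> P j \<longleftrightarrow> Q i"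
  shows "{\<sigma> i | i. Q i \<and> i \<in> {2..n}} = {phi n \<sigma> (j + 1) | j. P j \<and> j \<in> {1..n - 1}}"
proof -
  have "{phi n \<sigma> i | i. i \<in> {2..n}} = {\<sigma> i | i. i \<in> {2..n}}"
    using noninitial_letters[OF \<sigma>] noninitial_letters[OF phi_permutes[OF n \<sigma>]]
      phi_first[OF n \<sigma>] by simp
  moreover have "{phi n \<sigma> i | i. i \<in> {2..n}} = {phi n \<sigma> (j + 1) | j. j \<in> {1..n - 1}}"
  proof -
    have "{2..n} = (\<lambda>j. j + 1) ` {1..n - 1}"
      using n by (simp add: image_Suc_atLeastAtMost numeral_2_eq_2)
    then show ?thesis by (simp only: Setcompr_eq_image Collect_mem_eq image_image)
  qed
  ultimately have "{\<sigma> i | i. i \<in> {2..n}} = {phi n \<sigma> (j + 1) | j. j \<in> {1..n - 1}}" by simp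
  then show ?thesis using PQ by (smt (verit, best) Collect_cong mem_Collect_eq)
qed

text \<open>
  No letter is smaller than 1, so position 1 is never a drop, and drops range over the same
  positions as the other two statistics.
\<close>

lemma Drop_v_eq:
  assumes "n \<ge> 1" "\<sigma> permutes {1..n}"
  shows "Drop_v n \<sigma> = {\<sigma> i | i. \<sigma> i < i \<and> i \<in> {2..n}}"
proof -
  have "\<sigma> i < i \<and> i \<in> {1..n} \<longleftrightarrow> \<sigma> i < i \<and> i \<in> {2..n}" for i
  proof -
    have "\<sigma> 1 \<ge> 1" using permutes_in_image[OF assms(2), of 1] assms(1) by simp
    then show ?thesis by (cases "i = 1") auto
  qed
  then show ?thesis by (simp add: Drop_v_def)
qed

theorem theorem5p1:
  fixes n :: nat
  assumes "n \<ge> 1"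
  shows "bij_betw (phi n) (Sym_grp n) (Sym_grp n) \<and>
    (\<forall>\<sigma> \<in> Sym_grp n.
       phi n \<sigma> 1 = \<sigma> 1 \<and>
       (Exc_hat_v n \<sigma>, Drop_v n \<sigma>, Fix_hat n \<sigma>)
         = (Basc_B n (phi n \<sigma>), Des_B n (phi n \<sigma>), Suc_B n (phi n \<sigma>)) \<and>
       (exc_hat n \<sigma>, drop_num n \<sigma>, fix_hat n \<sigma>)
         = (basc_num n (phi n \<sigma>), des_num n (phi n \<sigma>), suc_num n (phi n \<sigma>)))"
proof (intro conjI ballI)
  show "bij_betw (phi n) (Sym_grp n) (Sym_grp n)" by (rule bij_betw_phi[OF assms])
next
  fix \<sigma> assume "\<sigma> \<in> Sym_grp n"
  then have \<sigma>: "\<sigma> permutes {1..n}" by (simp add: Sym_grp_def)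
  show "phi n \<sigma> 1 = \<sigma> 1" by (rule phi_first[OF assms \<sigma>])
  note sets_eq = phi_sets_eq[OF assms \<sigma>] and iff = phi_adjacent_iff[OF assms \<sigma>]
  have "Exc_hat_v n \<sigma> = Basc_B n (phi n \<sigma>)"
    unfolding Exc_hat_v_def Basc_B_def by (rule sets_eq) (rule iff(1))
  moreover have "Drop_v n \<sigma> = Des_B n (phi n \<sigma>)"
    unfolding Drop_v_eq[OF assms \<sigma>] Des_B_def by (rule sets_eq) (rule iff(3))
  moreover have "Fix_hat n \<sigma> = Suc_B n (phi n \<sigma>)"
  proof -
    have "Fix_hat n \<sigma> = {\<sigma> i | i. \<sigma> i = i \<and> i \<in> {2..n}}"
      unfolding Fix_hat_def by force
    also have "\<dots> = Suc_B n (phi n \<sigma>)"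
      unfolding Suc_B_def by (rule sets_eq) (rule iff(2))
    finally show ?thesis .
  qed
  ultimately show sets: "(Exc_hat_v n \<sigma>, Drop_v n \<sigma>, Fix_hat n \<sigma>)
      = (Basc_B n (phi n \<sigma>), Des_B n (phi n \<sigma>), Suc_B n (phi n \<sigma>))" by simp
  then show "(exc_hat n \<sigma>, drop_num n \<sigma>, fix_hat n \<sigma>)
      = (basc_num n (phi n \<sigma>), des_num n (phi n \<sigma>), suc_num n (phi n \<sigma>))"
    by (simp add: exc_hat_def drop_num_def fix_hat_def basc_num_def des_num_def suc_num_def)
qed

end
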